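(* There exists a sequence $(c_n)_{n\ge 0}$ of real numbers belonging to $X$ such that for every real $s>1/2$, $$\sup\{ n^s c_n : n\in\mathbb{N}\} = \infty .$$
   Context: $X$ denotes the space of (complex) sequences $(c_n)_{n\ge 0}$ such that $$\|(c_n)\|^2 = \sup\left\{ \frac{\sum_{k=0}^n (k+1)^2 |c_k|^2}{n+1} : n\in\mathbb{N}\right\} < \infty .$$ *)

theory Defs
  imports Complex_Main "HOL-Library.Extended_Real"
begin

text \<open>The supremum is taken in the extended reals, so that it is meaningful (and possibly
  infinite) for every sequence.\<close>

definition X_norm_sq :: "(nat \<Rightarrow> complex) \<Rightarrow> ereal" where
  "X_norm_sq c =
     (SUP n. ereal ((\<Sum>k=0..n. (real k + 1)\<^sup>2 * (cmod (c k))\<^sup>2) / (real n + 1)))"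

definition X_space :: "(nat \<Rightarrow> complex) set" where
  "X_space = {c. X_norm_sq c < \<infinity>}"

end

theory Submission
  imports Defs "HOL-Real_Asymp.Real_Asymp"
begin

text \<open>The norm of X controls only the averages of \<open>(k+1)\<^sup>2 |c\<^sub>k|\<^sup>2\<close>, so a single term may be as
  large as \<open>n+1\<close>, that is \<open>c\<^sub>n\<close> of order \<open>(n+1)\<^sup>-\<^sup>1\<^sup>/\<^sup>2\<close>, provided that such terms are sparse.
  The witness takes this extremal value at the indices \<open>n = 2\<^sup>j - 1\<close> and vanishes elsewhere: the
  geometric sum over the powers of two up to \<open>n+1\<close> is at most \<open>2 (n+1)\<close>, which gives
  membership in X, while along the subsequence \<open>n = 2\<^sup>j - 1\<close> the product \<open>n\<^sup>s c\<^sub>n\<close>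
  behaves like \<open>n\<^sup>s\<^sup>-\<^sup>1\<^sup>/\<^sup>2\<close>.\<close>

definition lacunary :: "nat \<Rightarrow> real" where
  "lacunary n = (if \<exists>j. n + 1 = 2 ^ j then 1 / sqrt (real n + 1) else 0)"

lemma lacunary_at_power: "lacunary (2 ^ j - 1) = 1 / sqrt (2 ^ j)"
  by (auto simp: lacunary_def of_nat_diff)

text \<open>The sum is indexed by the exponents \<open>j\<close>, where it is dominated by a full geometric series
  whose last term is the largest power of two not exceeding \<open>n+1\<close>.\<close>

lemma lacunary_weighted_sum_le:
  "(\<Sum>k=0..n. (real k + 1)\<^sup>2 * (lacunary k)\<^sup>2) \<le> 2 * (real n + 1)"
proof -
  obtain m where m: "2 ^ m \<le> n + 1" "n + 1 < 2 ^ (m + 1)"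
    using ex_power_ivl1[of 2 "n + 1"] by auto
  let ?f = "\<lambda>k. (real k + 1)\<^sup>2 * (lacunary k)\<^sup>2"
  let ?g = "\<lambda>j::nat. 2 ^ j - 1 :: nat"
  have f_power: "?f (?g j) = 2 ^ j" for j
    by (simp add: lacunary_at_power[unfolded One_nat_def] of_nat_diff power_divide power2_eq_square)
  have inj: "inj_on ?g {..m}"
    by (rule inj_onI) (metis Suc_diff_1 numeral_2_eq_2 one_less_numeral_iff pos2 power_inject_exp
        semiring_norm(76) zero_less_power)
  have zero: "?f k = 0" if "k \<in> {0..n} - ?g ` {..m}" for k
  proof -
    have "k + 1 \<noteq> 2 ^ j" for j
    proof
      assume k: "k + 1 = 2 ^ j"
      with that m(2) have "(2::nat) ^ j < 2 ^ (m + 1)" by auto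
      then have "j \<le> m"
        using power_less_imp_less_exp[of "2::nat" j "m + 1"] by simp
      moreover have "k = ?g j" using k by simp
      ultimately show False using that by blast
    qed
    then show ?thesis by (simp add: lacunary_def)
  qed
  have "sum ?f {0..n} = sum ?f ({0..n} \<inter> ?g ` {..m})"
    using zero by (intro sum.mono_neutral_right) auto
  also have "\<dots> \<le> sum ?f (?g ` {..m})"
    by (intro sum_mono2) auto
  also have "\<dots> = (\<Sum>j\<le>m. 2 ^ j)"
    unfolding sum.reindex[OF inj] o_def by (simp only: f_power)
  also have "\<dots> = 2 * 2 ^ m - 1"
    using sum_gp_strict[of "2::real" "Suc m"] by (simp add: lessThan_Suc_atMost)
  also have "\<dots> \<le> 2 * (real n + 1)"
  proof -
    have "real (2 ^ m) \<le> real (n + 1)" using m(1) by (intro of_nat_mono)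
    then show ?thesis by simp
  qed
  finally show ?thesis .
qed

lemma lacunary_in_X_space: "(\<lambda>n. complex_of_real (lacunary n)) \<in> X_space"
proof -
  have "X_norm_sq (\<lambda>n. complex_of_real (lacunary n)) \<le> ereal 2"
    unfolding X_norm_sq_def
  proof (rule SUP_least)
    fix n
    show "ereal ((\<Sum>k=0..n. (real k + 1)\<^sup>2 * (cmod (complex_of_real (lacunary k)))\<^sup>2) / (real n + 1))
          \<le> ereal 2"
      using lacunary_weighted_sum_le[of n] by (simp add: divide_le_eq)
  qed
  then show ?thesis
    by (auto simp: X_space_def intro: le_less_trans)
qed

lemma lacunary_growth:
  fixes s :: real
  assumes "s > 1 / 2"
  shows "filterlim (\<lambda>j::nat. real (2 ^ j - 1) powr s * lacunary (2 ^ j - 1)) at_top sequentially"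
proof -
  have "filterlim (\<lambda>x::real. (x - 1) powr s * (1 / sqrt x)) at_top at_top"
    using assms by real_asymp
  moreover have "filterlim (\<lambda>j::nat. (2::real) ^ j) at_top sequentially"
    by real_asymp
  ultimately have "filterlim (\<lambda>j::nat. ((2::real) ^ j - 1) powr s * (1 / sqrt (2 ^ j))) at_top sequentially"
    by (rule filterlim_compose)
  then show ?thesis
    by (simp add: lacunary_at_power[unfolded One_nat_def] of_nat_diff)
qed

theorem mainTheorem5:
  "\<exists>c :: nat \<Rightarrow> real.
     (\<lambda>n. complex_of_real (c n)) \<in> X_space \<and>
     (\<forall>s :: real. s > 1 / 2 \<longrightarrow> (SUP n. ereal (real n powr s * c n)) = \<infinity>)"
proof (intro exI[of _ lacunary] conjI allI impI)
  show "(\<lambda>n. complex_of_real (lacunary n)) \<in> X_space"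
    by (rule lacunary_in_X_space)
next
  fix s :: real
  assume "s > 1 / 2"
  show "(SUP n. ereal (real n powr s * lacunary n)) = \<infinity>"
  proof (rule SUP_PInfty)
    fix N :: nat
    have "\<forall>\<^sub>F j in sequentially. real N \<le> real (2 ^ j - 1) powr s * lacunary (2 ^ j - 1)"
      using lacunary_growth[OF \<open>s > 1 / 2\<close>] by (auto simp: filterlim_at_top)
    then obtain j where "real N \<le> real (2 ^ j - 1) powr s * lacunary (2 ^ j - 1)"
      by (auto simp: eventually_sequentially)
    then show "\<exists>n\<in>UNIV. ereal (real N) \<le> ereal (real n powr s * lacunary n)"
      by (intro bexI[of _ "2 ^ j - 1"]) auto
  qed
qed

end
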